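(* Let $\mathcal{G}$ be a digraph with $n$ nodes, let $C_H$ be a Hamiltonian cycle in $\mathcal{G}$, and let $W$ be any walk in $\mathcal{G}$. Then there is a walk $V$ in $\mathcal{G}$ with the same start and end nodes as $W$, obtained from $W$ by removing cycles and possibly inserting copies of $C_H$, such that $(n-1)^2+1\le\ell(V)\le(n-1)^2+n$ and $\ell(V)\equiv\ell(W)\pmod n$.
   Context: A walk is a sequence of nodes $(i_0,\dots,i_t)$ with each $(i_{s-1},i_s)$ an edge; its length $\ell$ is $t$. A cycle is a closed walk in which no node other than the start/end repeats. A Hamiltonian cycle is a cycle passing through all $n$ nodes. *)

theory Defs
  imports
    "Graph_Theory.Pair_Digraph"
    "Graph_Theory.Vertex_Walk"
    "HOL-Library.Multiset"
    "HOL-Number_Theory.Cong"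
begin

text \<open>
  A cycle has at least one arc, so a one-node walk is not a cycle, whereas a loop
  \<open>[v, v]\<close> is one. The start node is \<open>hd C = last C\<close>, so distinctness of
  \<open>tl C\<close> says that no node repeats apart from the coincidence of the two end points.
\<close>
definition vcycle :: "('a, 'b) pre_digraph \<Rightarrow> 'a vwalk \<Rightarrow> bool" where
  "vcycle G C \<longleftrightarrow> vwalk C G \<and> vwalk_length C \<ge> 1 \<and> hd C = last C \<and> distinct (tl C)"

definition hamiltonian_vcycle :: "('a, 'b) pre_digraph \<Rightarrow> 'a vwalk \<Rightarrow> bool" where
  "hamiltonian_vcycle G C \<longleftrightarrow> vcycle G C \<and> set C = verts G"

text \<open>
  \<open>V\<close> is obtained from \<open>W\<close> by removing cycles and possibly inserting copies of
  \<open>H\<close>. A walk is regarded here as the multiset of the arcs it traverses: a multiset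
  \<open>Cs\<close> of cycles that is jointly contained in \<open>W\<close> is taken out, \<open>k \<ge> 0\<close>
  copies of \<open>H\<close> are put in, and \<open>V\<close> traverses exactly the resulting arcs, each
  with its multiplicity. The order of traversal may change, so a removed cycle need not be a
  contiguous segment of \<open>W\<close>. This freedom is needed for the length bound: with
  contiguous removals only, the walk \<open>a b c b c a c a b\<close> of length 8 on the nodes
  \<open>a, b, c\<close>, with \<open>H = a b c a\<close>, cannot be brought to length 5, whereas here
  removing the cycle \<open>a b c a\<close> leaves the walk \<open>a c a b c b\<close>.
\<close>
definition remove_cycles_insert ::
  "('a, 'b) pre_digraph \<Rightarrow> 'a vwalk \<Rightarrow> 'a vwalk \<Rightarrow> 'a vwalk \<Rightarrow> bool" where
  "remove_cycles_insert G H W V \<longleftrightarrow>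
    (\<exists>(Cs :: 'a vwalk multiset) (k :: nat).
       (\<forall>C \<in># Cs. vcycle G C) \<and>
       (\<Sum>C\<in>#Cs. mset (vwalk_arcs C)) \<subseteq># mset (vwalk_arcs W) \<and>
       mset (vwalk_arcs V) =
         mset (vwalk_arcs W) - (\<Sum>C\<in>#Cs. mset (vwalk_arcs C))
           + repeat_mset k (mset (vwalk_arcs H)))"

end

theory Submission
  imports Defs
begin

text \<open>
  As a multiset of arcs, \<open>W\<close> is a path \<open>P\<close> together with cycles. Among these, take a minimal
  multiset \<open>Ds\<close> of cycles whose complement has total length divisible by \<open>n\<close> and remove the
  rest. By the pigeonhole principle on partial sums, \<open>Ds\<close> has at most \<open>n - 1\<close> members, and none
  has length \<open>n\<close>, so \<open>P\<close> and \<open>Ds\<close> have total length \<open>L \<le> n (n - 1)\<close>.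

  If \<open>L \<le> (n - 1)\<^sup>2\<close>, at least one copy of the Hamiltonian cycle is needed to reach the
  interval, and it connects everything. If \<open>L > (n - 1)\<^sup>2\<close>, no copy is needed and each cycle in
  \<open>Ds\<close> already meets \<open>P\<close>: a cycle of length \<open>c\<close> disjoint from a path of length \<open>p\<close> gives
  \<open>p + c \<le> n - 1\<close>, and the other at most \<open>n - 2\<close> cycles add at most \<open>(n - 1) (n - 2)\<close>,
  whence \<open>L \<le> (n - 1)\<^sup>2\<close>. Cycles meeting a walk can be spliced into it.
\<close>

section \<open>Arc multisets of walks: splicing and decomposition\<close>

lemma vwalk_arcs_join:
  assumes "p \<noteq> []" "q \<noteq> []" "last p = hd q"
  shows "vwalk_arcs (p @ tl q) = vwalk_arcs p @ vwalk_arcs q"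
proof (cases "tl q = []")
  case True
  then show ?thesis using assms(2) by (cases q) auto
next
  case False
  then have "q = hd q # tl q" using assms(2) by simp
  then have "vwalk_arcs q = (hd q, hd (tl q)) # vwalk_arcs (tl q)"
    using False vwalk_arcs_Cons by metis
  then show ?thesis using assms False by (simp add: vwalk_arcs_append)
qed

text \<open>Rotating \<open>C\<close> to begin at a node shared with \<open>U\<close> keeps its
  arcs, and the rotated walk can be inserted there. Since \<open>V\<close> also visits the nodes of
  \<open>C\<close>, later closed walks may attach through them.\<close>

lemma vwalk_splice_closed:
  assumes "vwalk U G" "vwalk C G" "hd C = last C" "set C \<inter> set U \<noteq> {}"
  obtains V where "vwalk V G" "hd V = hd U" "last V = last U" "set U \<union> set C \<subseteq> set V"
    "mset (vwalk_arcs V) = mset (vwalk_arcs U) + mset (vwalk_arcs C)"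
proof -
  obtain x where "x \<in> set C" "x \<in> set U" using assms(4) by blast
  then obtain a b c d where U: "U = a @ x # b" and C: "C = c @ x # d"
    by (meson split_list)
  \<comment> \<open>Follow \<open>U\<close> to \<open>x\<close>, then \<open>C\<close> from
    \<open>x\<close> to its end, \<open>C\<close> from its start back to \<open>x\<close>, and the
    rest of \<open>U\<close>. Each \<open>tl\<close> drops a duplicated junction node.\<close>
  define V where "V = (a @ [x]) @ tl (x # d) @ tl (c @ [x]) @ tl (x # b)"
  have hdC: "hd (c @ [x]) = last (x # d)"
    using assms(3) C by (cases c) auto
  have 1: "vwalk_arcs (p @ x # q) = vwalk_arcs (p @ [x]) @ vwalk_arcs (x # q)" for p q
    using vwalk_arcs_join[of "p @ [x]" "x # q"] by simp
  have rot: "vwalk_arcs ((x # d) @ tl (c @ [x])) = vwalk_arcs (x # d) @ vwalk_arcs (c @ [x])"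
    by (rule vwalk_arcs_join) (use hdC in auto)
  have lastrot: "last ((x # d) @ tl (c @ [x])) = x"
    using hdC by (cases c) auto
  have "vwalk_arcs V = vwalk_arcs (a @ [x]) @ vwalk_arcs (((x # d) @ tl (c @ [x])) @ tl (x # b))"
    using 1[of a "d @ tl (c @ [x]) @ b"] by (simp add: V_def)
  also have "vwalk_arcs (((x # d) @ tl (c @ [x])) @ tl (x # b)) =
      vwalk_arcs ((x # d) @ tl (c @ [x])) @ vwalk_arcs (x # b)"
    by (rule vwalk_arcs_join) (use lastrot in auto)
  finally have arcs: "mset (vwalk_arcs V) = mset (vwalk_arcs U) + mset (vwalk_arcs C)"
    using rot 1[of a b] 1[of c d] by (simp add: U C)
  have setV: "set V = set U \<union> set C"
    using hdC by (cases c; cases "d = []") (auto simp: V_def U C)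
  have "set (vwalk_arcs V) = set (vwalk_arcs U) \<union> set (vwalk_arcs C)"
    using arcs by (metis set_mset_mset set_mset_union)
  with assms(1,2) setV have "vwalk V G"
    by (auto simp: vwalk_def)
  moreover have "hd V = hd U" by (cases a) (auto simp: V_def U)
  moreover have "last V = last U"
    using lastrot by (cases "b = []") (auto simp: V_def U)
  ultimately show thesis using that arcs setV by blast
qed

text \<open>Splicing loses no node, so whatever meets \<open>U\<close> still meets the walk after
  earlier insertions.\<close>

lemma vwalk_splice_closed_multiset:
  assumes "vwalk U G"
    and "\<forall>C\<in>#Cs. vwalk C G \<and> hd C = last C \<and> set C \<inter> set U \<noteq> {}"
  obtains V where "vwalk V G" "hd V = hd U" "last V = last U" "set U \<subseteq> set V"
    "mset (vwalk_arcs V) = mset (vwalk_arcs U) + (\<Sum>C\<in>#Cs. mset (vwalk_arcs C))"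
proof -
  have "\<exists>V. vwalk V G \<and> hd V = hd U \<and> last V = last U \<and> set U \<subseteq> set V \<and>
    mset (vwalk_arcs V) = mset (vwalk_arcs U) + (\<Sum>C\<in>#Cs. mset (vwalk_arcs C))"
    using assms(2)
  proof (induction Cs)
    case empty
    then show ?case using assms(1) by auto
  next
    case (add C Cs)
    then obtain V where V: "vwalk V G" "hd V = hd U" "last V = last U" "set U \<subseteq> set V"
      "mset (vwalk_arcs V) = mset (vwalk_arcs U) + (\<Sum>C\<in>#Cs. mset (vwalk_arcs C))"
      by auto
    have C: "vwalk C G" "hd C = last C" "set C \<inter> set V \<noteq> {}"
      using add.prems V(4) by auto
    obtain V' where "vwalk V' G" "hd V' = hd V" "last V' = last V" "set V \<union> set C \<subseteq> set V'"
      "mset (vwalk_arcs V') = mset (vwalk_arcs V) + mset (vwalk_arcs C)"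
      using vwalk_splice_closed[OF V(1) C] by blast
    then show ?case using V by (intro exI[of _ V']) (auto simp: add_ac)
  qed
  then show thesis using that by blast
qed

text \<open>Induction from the front of the walk: a node prepended to the path either extends it or
  closes a cycle with an initial segment of it, and the rest remains a path.\<close>

lemma vwalk_path_cycle_decomposition:
  assumes "vwalk W G"
  obtains P Cs where "vpath P G" "hd P = hd W" "last P = last W"
    "\<forall>C\<in>#Cs. vcycle G C"
    "mset (vwalk_arcs W) = mset (vwalk_arcs P) + (\<Sum>C\<in>#Cs. mset (vwalk_arcs C))"
proof -
  have "\<exists>P Cs. vpath P G \<and> hd P = hd W \<and> last P = last W \<and> (\<forall>C\<in>#Cs. vcycle G C) \<and>
    mset (vwalk_arcs W) = mset (vwalk_arcs P) + (\<Sum>C\<in>#Cs. mset (vwalk_arcs C))"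
    using assms
  proof (induction W rule: list.induct)
    case Nil
    then show ?case by (simp add: vwalk_def)
  next
    case (Cons a W)
    show ?case
    proof (cases "W = []")
      case True
      with Cons.prems show ?thesis
        by (intro exI[of _ "[a]"] exI[of _ "{#}"]) (auto simp: vpath_def)
    next
      case False
      then have W: "(a, hd W) \<in> arcs_ends G" "vwalk W G" "a \<in> verts G"
        using Cons.prems by (auto elim: vwalk_consE)
      from Cons.IH[OF W(2)] obtain P Cs where P: "vpath P G" "hd P = hd W" "last P = last W"
        and Cs: "\<forall>C\<in>#Cs. vcycle G C"
        and arcs: "mset (vwalk_arcs W) = mset (vwalk_arcs P) + (\<Sum>C\<in>#Cs. mset (vwalk_arcs C))"
        by blast
      have ne: "P \<noteq> []" and wP: "vwalk P G" and dP: "distinct P"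
        using P(1) by (auto simp: vpath_def vwalk_def)
      have aP: "vwalk (a # P) G" by (rule vwalk_consI) (use W P wP in auto)
      have arcs': "mset (vwalk_arcs (a # W)) =
          mset (vwalk_arcs (a # P)) + (\<Sum>C\<in>#Cs. mset (vwalk_arcs C))"
        using arcs False ne P(2) by simp
      show ?thesis
      proof (cases "a \<in> set P")
        case False
        with aP dP have "vpath (a # P) G" by (simp add: vpath_def)
        then show ?thesis using arcs' Cs P ne \<open>W \<noteq> []\<close>
          by (intro exI[of _ "a # P"] exI[of _ Cs]) auto
      next
        case True
        then obtain p q where pq: "P = p @ a # q" by (meson split_list)
        \<comment> \<open>The cycle split off is \<open>a # p @ [a]\<close>; it is a loop if
          \<open>p = []\<close>.\<close>
        have split: "vwalk_arcs (a # P) = vwalk_arcs (a # p @ [a]) @ vwalk_arcs (a # q)"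
          using vwalk_arcs_join[of "a # p @ [a]" "a # q"] by (simp add: pq)
        have "vwalk (a # p @ [a]) G"
          using vwalkI_append_l[of "a # p @ [a]" q G] aP by (simp add: pq)
        then have cyc: "vcycle G (a # p @ [a])"
          using dP by (auto simp: vcycle_def pq)
        have "vpath (a # q) G"
          using vwalkI_append_r[of "a # q" p G] wP dP by (simp add: pq vpath_def)
        then show ?thesis using split arcs' Cs cyc P(3) \<open>W \<noteq> []\<close>
          by (intro exI[of _ "a # q"] exI[of _ "add_mset (a # p @ [a]) Cs"]) (auto simp: pq)
      qed
    qed
  qed
  then show thesis using that by blast
qed

section \<open>Sub-multisets with sum divisible by \<open>n\<close>\<close>

lemma exists_sub_multiset_sum_dvd:
  fixes f :: "'c \<Rightarrow> nat"
  assumes "n > 0" "n \<le> size M"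
  obtains E where "E \<subseteq># M" "E \<noteq> {#}" "n dvd (\<Sum>x\<in>#E. f x)"
proof -
  obtain xs where xs: "mset xs = M" using ex_mset by blast
  \<comment> \<open>With the empty prefix there are \<open>n + 1\<close> prefix sums but only
    \<open>n\<close> residues, so two agree; the segment between them is the required
    sub-multiset.\<close>
  define s where "s i = (\<Sum>x\<leftarrow>take i xs. f x) mod n" for i
  have "card (s ` {0..n}) \<le> card {0..<n}"
    using assms(1) by (intro card_mono) (auto simp: s_def)
  then have "\<not> inj_on s {0..n}"
    using card_image[of s "{0..n}"] by auto
  then obtain i j where ij: "i < j" "j \<le> n" "s i = s j"
    unfolding inj_on_def by (metis atLeastAtMost_iff linorder_neqE_nat)
  define ys where "ys = drop i (take j xs)"
  have tj: "take j xs = take i xs @ ys"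
    using ij(1) append_take_drop_id[of i "take j xs"] by (simp add: ys_def min_def)
  then have "xs = take i xs @ ys @ drop j xs"
    using append_take_drop_id[of j xs] by simp
  then have "M = mset (take i xs) + mset ys + mset (drop j xs)"
    using xs by (metis mset_append add.assoc)
  then have "mset ys \<subseteq># M" by simp
  moreover have "mset ys \<noteq> {#}"
    using ij assms(2) xs by (auto simp: ys_def)
  moreover have "n dvd (\<Sum>x\<leftarrow>take i xs. f x) + (\<Sum>x\<leftarrow>ys. f x) - (\<Sum>x\<leftarrow>take i xs. f x)"
    using ij(3) mod_eq_dvd_iff_nat[of "\<Sum>x\<leftarrow>take i xs. f x" "\<Sum>x\<leftarrow>take j xs. f x" n]
    by (simp add: s_def tj)
  then have "n dvd (\<Sum>x\<in>#mset ys. f x)"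
    by (simp flip: sum_mset_sum_list)
  ultimately show thesis using that by blast
qed

text \<open>Choose \<open>D\<close> of least size. A part \<open>E\<close> of \<open>D\<close> with
  sum divisible by \<open>n\<close> could move to the complement, so \<open>E\<close> is empty;
  pigeonhole then bounds \<open>size D\<close>, and singletons give the last claim.\<close>

lemma exists_sub_multiset_cong:
  fixes f :: "'c \<Rightarrow> nat"
  assumes "n > 0"
  obtains D where "D \<subseteq># M" "n dvd (\<Sum>x\<in>#M - D. f x)" "size D < n" "\<forall>x\<in>#D. \<not> n dvd f x"
proof -
  define Q where "Q D \<longleftrightarrow> D \<subseteq># M \<and> n dvd (\<Sum>x\<in>#M - D. f x)" for D
  have "Q M" by (simp add: Q_def)
  then obtain D where D: "Q D" and min: "\<And>D'. Q D' \<Longrightarrow> size D \<le> size D'"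
    using exists_least_iff[of "\<lambda>k. \<exists>D. Q D \<and> size D = k"] by (metis not_le)
  have zero_sum_free: "E = {#}" if "E \<subseteq># D" "n dvd (\<Sum>x\<in>#E. f x)" for E
  proof -
    have diff: "M - (D - E) = (M - D) + E"
      using D that(1) by (auto simp: Q_def multiset_eq_iff subseteq_mset_def)
    then have "Q (D - E)"
      using D that(2) unfolding Q_def diff
      unfolding image_mset_union sum_mset.union
      by (blast intro: subset_mset.order_trans[OF diff_subset_eq_self] dvd_add)
    then have "size D \<le> size D - size E" using min that(1) size_Diff_submset by metis
    moreover have "size E \<le> size D" using that(1) by (rule size_mset_mono)
    ultimately have "size E = 0" by linarith
    then show ?thesis by simp
  qed
  have "size D < n"
  proof (rule ccontr)
    assume "\<not> size D < n"
    then have "n \<le> size D" by simp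
    then show False
      using exists_sub_multiset_sum_dvd[OF assms, of D f] zero_sum_free by blast
  qed
  moreover have "\<not> n dvd f x" if "x \<in># D" for x
    using zero_sum_free[of "{#x#}"] that by auto
  ultimately show thesis using that D by (auto simp: Q_def)
qed

section \<open>Length computations\<close>

lemma sum_mset_le_size_mult:
  fixes f :: "'c \<Rightarrow> nat"
  assumes "\<forall>x\<in>#M. f x \<le> b"
  shows "(\<Sum>x\<in>#M. f x) \<le> size M * b"
  using assms by (induction M) auto

text \<open>Turns equations between arc multisets into equations between lengths.\<close>

lemma vwalk_length_size: "vwalk_length p = size (mset (vwalk_arcs p))"
  by (simp add: vwalk_length_def del: vwalk_length_simp)

lemma size_sum_mset_vwalk_arcs:
  "size (\<Sum>C\<in>#Cs. mset (vwalk_arcs C)) = (\<Sum>C\<in>#Cs. vwalk_length C)"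
  by (induction Cs) (simp_all add: vwalk_length_size del: vwalk_length_simp)

lemma vcycle_set_tl: "vcycle G C \<Longrightarrow> set (tl C) = set C"
  by (cases C) (auto simp: vcycle_def split: if_splits)

text \<open>The start recurs at the end, so \<open>tl C\<close> lists every node exactly
  once.\<close>

lemma vcycle_length_eq_card: "vcycle G C \<Longrightarrow> vwalk_length C = card (set C)"
  using vcycle_set_tl[of G C] distinct_card[of "tl C"] by (simp add: vcycle_def)

text \<open>The target is a window of \<open>n\<close> consecutive integers lying above
  \<open>L\<close>, so \<open>k\<close> is positive; this guarantees a copy of the Hamiltonian
  cycle.\<close>

lemma exists_multiple_in_interval:
  fixes a n L :: nat
  assumes "n > 0" "L \<le> a"
  obtains k where "k > 0" "a + 1 \<le> L + k * n" "L + k * n \<le> a + n"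
proof -
  define q where "q = (a - L) div n"
  have "q * n + (a - L) mod n = a - L" "(a - L) mod n < n"
    using assms(1) by (auto simp: q_def)
  then have "a + 1 \<le> L + (q * n + n)" "L + (q * n + n) \<le> a + n"
    using assms(2) by linarith+
  then show thesis using that[of "Suc q"] by (simp add: add.commute)
qed

section \<open>Construction of the walk\<close>

theorem theorem5p2:
  fixes G :: "'a pair_pre_digraph" and n :: nat and C\<^sub>H W :: "'a vwalk"
  assumes "pair_fin_digraph G"
    and "card (pverts G) = n"
    and "hamiltonian_vcycle (with_proj G) C\<^sub>H"
    and "vwalk W (with_proj G)"
  shows "\<exists>V. vwalk V (with_proj G) \<and> hd V = hd W \<and> last V = last W \<and>
    remove_cycles_insert (with_proj G) C\<^sub>H W V \<and>
    (n - 1)\<^sup>2 + 1 \<le> vwalk_length V \<and> vwalk_length V \<le> (n - 1)\<^sup>2 + n \<and>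
    [vwalk_length V = vwalk_length W] (mod n)"
proof -
  let ?G = "with_proj G"
  let ?len = "\<lambda>Cs. \<Sum>C\<in>#Cs. vwalk_length C" and ?arcs = "\<lambda>Cs. \<Sum>C\<in>#Cs. mset (vwalk_arcs C)"
  have H: "vcycle ?G C\<^sub>H" and setH: "set C\<^sub>H = pverts G"
    using assms(3) by (auto simp: hamiltonian_vcycle_def)
  have fin: "finite (pverts G)" using setH by (metis List.finite_set)
  have lenH: "vwalk_length C\<^sub>H = n"
    using vcycle_length_eq_card[OF H] setH assms(2) by simp
  then have n: "n > 0" using H by (simp add: vcycle_def)
  obtain P Cs where P: "vpath P ?G" "hd P = hd W" "last P = last W"
    and Cs: "\<forall>C\<in>#Cs. vcycle ?G C"
    and W: "mset (vwalk_arcs W) = mset (vwalk_arcs P) + ?arcs Cs"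
    using vwalk_path_cycle_decomposition[OF assms(4)] by blast
  obtain Ds where Ds: "Ds \<subseteq># Cs" "n dvd ?len (Cs - Ds)" "size Ds < n"
    "\<forall>C\<in>#Ds. \<not> n dvd vwalk_length C"
    using exists_sub_multiset_cong[OF n] by blast
  \<comment> \<open>The cycles in \<open>Rs\<close> are removed and those in \<open>Ds\<close> kept;
    the total length of \<open>Rs\<close> is a multiple of \<open>n\<close>, so residues
    survive.\<close>
  define Rs where "Rs = Cs - Ds"
  have CsRs: "Cs = Rs + Ds" using Ds(1) by (simp add: Rs_def)
  have wP: "vwalk P ?G" and dP: "distinct P" and Pne: "P \<noteq> []" and Pv: "set P \<subseteq> pverts G"
    using P(1) by (auto simp: vpath_def vwalk_def)
  have lenP: "vwalk_length P + 1 = card (set P)"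
    using distinct_card[OF dP] Pne by (cases P) auto
  have Dcyc: "vcycle ?G C" "set C \<subseteq> pverts G" if "C \<in># Ds" for C
    using Cs that CsRs by (auto simp: vcycle_def vwalk_def)
  have Dlen: "\<forall>C\<in>#Ds. vwalk_length C \<le> n - 1"
  proof
    fix C assume C: "C \<in># Ds"
    have "vwalk_length C \<le> n"
      using vcycle_length_eq_card[OF Dcyc(1)[OF C]] card_mono[OF fin Dcyc(2)[OF C]] assms(2)
      by simp
    moreover have "vwalk_length C \<noteq> n" using Ds(4) C by (metis dvd_refl)
    ultimately show "vwalk_length C \<le> n - 1" by linarith
  qed
  define L where "L = vwalk_length P + ?len Ds"
  have lenW: "vwalk_length W = L + ?len Rs"
    unfolding vwalk_length_size[of W] W L_def size_union size_sum_mset_vwalk_arcs CsRs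
      vwalk_length_size[of P] by (simp del: vwalk_length_simp)
  have "vwalk_length P + 1 \<le> n"
    using lenP card_mono[OF fin Pv] assms(2) by linarith
  moreover have "?len Ds \<le> (n - 1) * (n - 1)"
    using sum_mset_le_size_mult[OF Dlen] mult_right_mono[of "size Ds" "n - 1" "n - 1"] Ds(3)
    by linarith
  ultimately have L_le: "L \<le> (n - 1)\<^sup>2 + n" by (simp add: L_def power2_eq_square)
  \<comment> \<open>It remains to choose \<open>k\<close> and to join \<open>P\<close>,
    \<open>Ds\<close> and \<open>k\<close> copies of \<open>C\<^sub>H\<close> into one walk.\<close>
  have conclusion: ?thesis
    if V: "vwalk V ?G" "hd V = hd P" "last V = last P"
      "mset (vwalk_arcs V) = mset (vwalk_arcs P) + ?arcs (Ds + replicate_mset k C\<^sub>H)"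
      and k: "(n - 1)\<^sup>2 + 1 \<le> L + k * n" "L + k * n \<le> (n - 1)\<^sup>2 + n" for V k
  proof -
    have rep: "\<Sum>\<^sub># (replicate_mset k X) = repeat_mset k X" for X :: "('a \<times> 'a) multiset"
      by (induction k) auto
    have lenV: "vwalk_length V = L + k * n"
      unfolding vwalk_length_size[of V] V(4) L_def size_union size_sum_mset_vwalk_arcs
        vwalk_length_size[of P] using lenH by (simp del: vwalk_length_simp)
    have "remove_cycles_insert ?G C\<^sub>H W V"
      unfolding remove_cycles_insert_def
      by (intro exI[of _ Rs] exI[of _ k]) (use Cs in \<open>auto simp: V(4) W CsRs rep\<close>)
    moreover have "[vwalk_length V = vwalk_length W] (mod n)"
      using Ds(2) unfolding lenV lenW Rs_def
      by (simp add: cong_def mod_add_right_eq[of L, symmetric] del: vwalk_length_simp)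
    ultimately show ?thesis using V k P lenV by (intro exI[of _ V]) auto
  qed
  show ?thesis
  proof (cases "L \<le> (n - 1)\<^sup>2")
    case True
    then obtain k where k: "k > 0" "(n - 1)\<^sup>2 + 1 \<le> L + k * n" "L + k * n \<le> (n - 1)\<^sup>2 + n"
      using exists_multiple_in_interval[OF n] by metis
    \<comment> \<open>One copy is spliced into \<open>P\<close> first: the result \<open>U\<close>
      visits every node, so \<open>Ds\<close> and the other \<open>k'\<close> copies all meet
      it.\<close>
    obtain k' where k': "k = Suc k'" using k(1) by (cases k) auto
    have "vwalk C\<^sub>H ?G" "hd C\<^sub>H = last C\<^sub>H" "set C\<^sub>H \<inter> set P \<noteq> {}"
      using H Pne Pv setH by (auto simp: vcycle_def Int_absorb1)
    from vwalk_splice_closed[OF wP this] obtain U where U: "vwalk U ?G" "hd U = hd P"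
      "last U = last P" "set P \<union> set C\<^sub>H \<subseteq> set U"
      "mset (vwalk_arcs U) = mset (vwalk_arcs P) + mset (vwalk_arcs C\<^sub>H)" by blast
    have "vwalk C ?G \<and> hd C = last C \<and> set C \<inter> set U \<noteq> {}"
      if "C \<in># Ds + replicate_mset k' C\<^sub>H" for C
    proof -
      have C: "vcycle ?G C" using that Dcyc H by (auto split: if_splits)
      then have "C \<noteq> []" "set C \<subseteq> set U"
        using U(4) setH by (auto simp: vcycle_def vwalk_def)
      then show ?thesis using C by (auto simp: vcycle_def Int_absorb2)
    qed
    then obtain V where "vwalk V ?G" "hd V = hd U" "last V = last U"
      "mset (vwalk_arcs V) = mset (vwalk_arcs U) + ?arcs (Ds + replicate_mset k' C\<^sub>H)"
      using vwalk_splice_closed_multiset[OF U(1)] by metis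
    then show ?thesis using conclusion[of V k] k U by (simp add: k' add_ac)
  next
    case False
    have "set C \<inter> set P \<noteq> {}" if C: "C \<in># Ds" for C
    proof
      assume "set C \<inter> set P = {}"
      then have "vwalk_length C + (vwalk_length P + 1) = card (set C \<union> set P)"
        using lenP vcycle_length_eq_card[OF Dcyc(1)[OF C]] by (simp add: card_Un_disjoint)
      also have "\<dots> \<le> n" using card_mono[OF fin] Dcyc(2)[OF C] Pv assms(2) by blast
      finally have short: "vwalk_length C + vwalk_length P \<le> n - 1" by linarith
      obtain Es where Es: "Ds = add_mset C Es" using C by (metis mset_add)
      have "?len Es \<le> size Es * (n - 1)" by (rule sum_mset_le_size_mult) (use Dlen Es in auto)
      \<comment> \<open>Besides \<open>C\<close>, at most \<open>n - 2\<close> cycles are left; as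
        \<open>Ds\<close> is nonempty, \<open>n \<ge> 2\<close> and the subtraction is not
        truncated.\<close>
      also have "\<dots> \<le> (n - 2) * (n - 1)" using Ds(3) Es by (intro mult_right_mono) auto
      finally have "L \<le> (n - 1) + (n - 2) * (n - 1)" using short Es by (simp add: L_def)
      also have "\<dots> = (n - 1)\<^sup>2"
      proof -
        have "n - 1 = Suc (n - 2)" using Ds(3) Es by simp
        then show ?thesis by (simp add: power2_eq_square)
      qed
      finally show False using False by simp
    qed
    then have "\<forall>C\<in>#Ds. vwalk C ?G \<and> hd C = last C \<and> set C \<inter> set P \<noteq> {}"
      using Dcyc by (auto simp: vcycle_def)
    then obtain V where "vwalk V ?G" "hd V = hd P" "last V = last P"
      "mset (vwalk_arcs V) = mset (vwalk_arcs P) + ?arcs Ds"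
      using vwalk_splice_closed_multiset[OF wP] by metis
    \<comment> \<open>With \<open>k = 0\<close> the case assumption is the lower bound and
      \<open>L_le\<close> the upper one.\<close>
    then show ?thesis using conclusion[of V 0] False L_le by simp
  qed
qed

end
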